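(* Let $X=(X_t)_{t\in\mathbb R}$ be a splittable stationary random process, and let $\sigma\in[0,\infty)$ be the number such that for every compactly supported continuous $g:\mathbb R\to\mathbb R$, $$\lim_{r\to\infty,\ \lambda\to0,\ \lambda\log r\to0}\frac1{r\lambda^2}\ln\mathbb E\exp\Big(\lambda\int_{-\infty}^\infty g\Big(\frac tr\Big)X_t\,dt\Big)=\frac{\sigma^2}2\|g\|^2_{L_2(\mathbb R)}$$ (such a number exists). Let $f:\mathbb R\to\mathbb R$ be a compactly supported continuous function. Then the distribution of $r^{-1/2}\int f\big(\frac tr\big)X_t\,dt$ converges weakly, as $r\to\infty$, to the normal distribution $N(0,\sigma^2\|f\|^2_{L_2(\mathbb R)})$.
   Context: A random process is a (jointly) measurable map $X:\mathbb R\times\Omega\to\mathbb R$ on a probability space; two such maps that agree almost surely at every $t\in\mathbb R$ are identified. Processes (possibly on different probability spaces) are identically distributed if they have the same finite-dimensional distributions; processes on the same probability space are independent if all their finite-dimensional vectors are independent. $X$ is stationary if for every $s\in\mathbb R$ the shifted process $(X_{s+t})_t$ is distributed like $X$. A stationary random process $X$ is *splittable* if $\mathbb E\exp|X_0|<\infty$, $\mathbb E X_0=0$, and there exists (on some probability space) a triple of random processes $X^0,X^-,X^+$ such that: (a) $X^-$ and $X^+$ are independent; (b) the four processes $X,X^0,X^-,X^+$ are identically distributed; (c) $\mathbb E\exp\big(\int_{-\infty}^0|X^-_t-X^0_t|\,dt+\int_0^\infty|X^+_t-X^0_t|\,dt\big)<\infty$. The limit in the claim means: for every $\varepsilon>0$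 there exist $R$ and $\delta>0$ such that the expression is within $\varepsilon$ of the right-hand side for all $r\ge R$ and all $\lambda\ne0$ with $|\lambda|\log r\le\delta$. $N(0,0)$ denotes the unit mass at $0$. *)

theory Defs
  imports "HOL-Probability.Probability"
begin

section \<open>Random processes\<close>

definition random_process :: "'a measure \<Rightarrow> (real \<Rightarrow> 'a \<Rightarrow> real) \<Rightarrow> bool" where
  "random_process M X \<longleftrightarrow>
     prob_space M \<and> case_prod X \<in> borel_measurable (borel \<Otimes>\<^sub>M M)"

text \<open>The vector \<open>(X\<^sub>t)\<close>, \<open>t \<in> J\<close>, viewed as a map into the product space over \<open>J\<close>.\<close>

definition fd_vector :: "(real \<Rightarrow> 'a \<Rightarrow> real) \<Rightarrow> real set \<Rightarrow> 'a \<Rightarrow> real \<Rightarrow> real" where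
  "fd_vector X J \<omega> = (\<lambda>t\<in>J. X t \<omega>)"

definition identically_distributed ::
  "'a measure \<Rightarrow> (real \<Rightarrow> 'a \<Rightarrow> real) \<Rightarrow> 'b measure \<Rightarrow> (real \<Rightarrow> 'b \<Rightarrow> real) \<Rightarrow> bool" where
  "identically_distributed M X N Y \<longleftrightarrow>
     (\<forall>J. finite J \<longrightarrow>
        distr M (Pi\<^sub>M J (\<lambda>_. borel)) (fd_vector X J) = distr N (Pi\<^sub>M J (\<lambda>_. borel)) (fd_vector Y J))"

definition independent_processes ::
  "'a measure \<Rightarrow> (real \<Rightarrow> 'a \<Rightarrow> real) \<Rightarrow> (real \<Rightarrow> 'a \<Rightarrow> real) \<Rightarrow> bool" where
  "independent_processes M X Y \<longleftrightarrow>
     (\<forall>I J. finite I \<longrightarrow> finite J \<longrightarrow>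
        prob_space.indep_var M (Pi\<^sub>M I (\<lambda>_. borel)) (fd_vector X I) (Pi\<^sub>M J (\<lambda>_. borel)) (fd_vector Y J))"

definition stationary :: "'a measure \<Rightarrow> (real \<Rightarrow> 'a \<Rightarrow> real) \<Rightarrow> bool" where
  "stationary M X \<longleftrightarrow> (\<forall>s. identically_distributed M (\<lambda>t. X (s + t)) M X)"


section \<open>Splittability\<close>

definition exp_ennreal :: "ennreal \<Rightarrow> ennreal" where
  "exp_ennreal x = (if x = \<infinity> then \<infinity> else ennreal (exp (enn2real x)))"

text \<open>
  The auxiliary probability space of the three processes lives on the type \<open>'b\<close>. HOL cannot
  quantify over types inside a definition, so \<open>'b\<close> is a parameter. In a theorem having
  \<open>splittable TYPE('b) M X\<close> as a hypothesis and not mentioning \<open>'b\<close> elsewhere, \<open>'b\<close> is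
  universally quantified, so the theorem applies whenever the triple exists on some
  probability space.
\<close>

definition splittable :: "'b itself \<Rightarrow> 'a measure \<Rightarrow> (real \<Rightarrow> 'a \<Rightarrow> real) \<Rightarrow> bool" where
  "splittable (_ :: 'b itself) M X \<longleftrightarrow>
     integrable M (\<lambda>\<omega>. exp \<bar>X 0 \<omega>\<bar>) \<and>
     (\<integral>\<omega>. X 0 \<omega> \<partial>M) = 0 \<and>
     (\<exists>(N :: 'b measure) X0 Xm Xp.
        random_process N X0 \<and> random_process N Xm \<and> random_process N Xp \<and>
        independent_processes N Xm Xp \<and>
        identically_distributed M X N X0 \<and>
        identically_distributed M X N Xm \<and>
        identically_distributed M X N Xp \<and>
        (\<integral>\<^sup>+\<omega>. exp_ennreal
            ((\<integral>\<^sup>+t\<in>{..0}. ennreal \<bar>Xm t \<omega> - X0 t \<omega>\<bar> \<partial>lborel) +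
             (\<integral>\<^sup>+t\<in>{0..}. ennreal \<bar>Xp t \<omega> - X0 t \<omega>\<bar> \<partial>lborel)) \<partial>N) < \<infinity>)"


section \<open>Linear functionals of a process and the exponential moment asymptotics\<close>

definition compactly_supported :: "(real \<Rightarrow> real) \<Rightarrow> bool" where
  "compactly_supported g \<longleftrightarrow> compact (closure {t. g t \<noteq> 0})"

definition L2_norm :: "(real \<Rightarrow> real) \<Rightarrow> real" where
  "L2_norm g = sqrt (LBINT t. (g t)\<^sup>2)"

definition scaled_integral :: "(real \<Rightarrow> real) \<Rightarrow> (real \<Rightarrow> 'a \<Rightarrow> real) \<Rightarrow> real \<Rightarrow> 'a \<Rightarrow> real" where
  "scaled_integral g X r \<omega> = (LBINT t. g (t / r) * X t \<omega>)"

text \<open>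
  The integrability clause says that the expectation is finite; a Bochner integral of a
  non-integrable function would otherwise be \<open>0\<close>. Requiring \<open>R > 1\<close> loses no generality
  (\<open>R\<close> can always be increased) and keeps \<open>ln r\<close> positive.
\<close>

definition log_exp_moment_limit :: "'a measure \<Rightarrow> (real \<Rightarrow> 'a \<Rightarrow> real) \<Rightarrow> (real \<Rightarrow> real) \<Rightarrow> real \<Rightarrow> bool" where
  "log_exp_moment_limit M X g L \<longleftrightarrow>
     (\<forall>\<epsilon>>0. \<exists>R>1. \<exists>\<delta>>0. \<forall>r\<ge>R. \<forall>l. l \<noteq> 0 \<and> \<bar>l\<bar> * ln r \<le> \<delta> \<longrightarrow>
        integrable M (\<lambda>\<omega>. exp (l * scaled_integral g X r \<omega>)) \<and>
        \<bar>1 / (r * l\<^sup>2) * ln (\<integral>\<omega>. exp (l * scaled_integral g X r \<omega>) \<partial>M) - L\<bar> < \<epsilon>)"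


section \<open>Weak convergence along a filter and normal distributions\<close>

definition weakly_converges :: "('i \<Rightarrow> real measure) \<Rightarrow> real measure \<Rightarrow> 'i filter \<Rightarrow> bool" where
  "weakly_converges \<mu> \<nu> F \<longleftrightarrow>
     (\<forall>\<phi> :: real \<Rightarrow> real. continuous_on UNIV \<phi> \<longrightarrow> bounded (range \<phi>) \<longrightarrow>
        ((\<lambda>i. \<integral>x. \<phi> x \<partial>\<mu> i) \<longlongrightarrow> (\<integral>x. \<phi> x \<partial>\<nu>)) F)"

text \<open>For sequences this is the library's notion of weak convergence.\<close>

lemma weakly_converges_sequentially_iff:
  assumes "\<And>n. real_distribution (\<mu> n)" and "real_distribution \<nu>"
  shows "weakly_converges \<mu> \<nu> sequentially \<longleftrightarrow> weak_conv_m \<mu> \<nu>"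
proof
  assume w: "weakly_converges \<mu> \<nu> sequentially"
  show "weak_conv_m \<mu> \<nu>"
  proof (rule integral_bdd_continuous_conv_imp_weak_conv[OF assms])
    fix f :: "real \<Rightarrow> real" assume "\<And>x. isCont f x" and b: "\<And>x. \<bar>f x\<bar> \<le> 1"
    then have "continuous_on UNIV f"
      by (simp add: continuous_at_imp_continuous_on)
    moreover have "bounded (range f)"
      using b by (auto simp: bounded_iff)
    ultimately show "(\<lambda>n. integral\<^sup>L (\<mu> n) f) \<longlonglongrightarrow> integral\<^sup>L \<nu> f"
      using w by (simp add: weakly_converges_def)
  qed
next
  assume w: "weak_conv_m \<mu> \<nu>"
  show "weakly_converges \<mu> \<nu> sequentially"
    unfolding weakly_converges_def
  proof (intro allI impI)
    fix f :: "real \<Rightarrow> real" assume c: "continuous_on UNIV f" and "bounded (range f)"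
    then obtain B where "\<And>x. norm (f x) \<le> B"
      by (auto simp: bounded_iff)
    with c show "(\<lambda>n. integral\<^sup>L (\<mu> n) f) \<longlonglongrightarrow> integral\<^sup>L \<nu> f"
      by (intro weak_conv_imp_integral_bdd_continuous_conv[OF assms w])
         (auto simp: continuous_on_eq_continuous_at)
  qed
qed

text \<open>
  The second parameter is the variance. The library's density is meaningless for standard
  deviation \<open>0\<close>, so the degenerate case is separate.
\<close>

definition normal_distribution :: "real \<Rightarrow> real \<Rightarrow> real measure" where
  "normal_distribution m v =
     (if v = 0 then return borel m else density lborel (\<lambda>x. ennreal (normal_density m (sqrt v) x)))"

end

theory Submission
  imports Defs "HOL-Real_Asymp.Real_Asymp"
begin

text \<open>
  Write \<open>Y\<^sub>r = r powr (-1/2) * \<integral> f (t / r) X\<^sub>t dt\<close> and \<open>v = \<sigma>\<^sup>2 \<parallel>f\<parallel>\<^sup>2\<close>. For fixed \<open>s \<noteq> 0\<close>, the exponential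
  moment asymptotics may be used along \<open>\<lambda> = s r powr (-1/2)\<close>, because then \<open>\<lambda> ln r \<rightarrow> 0\<close>. Since
  \<open>r \<lambda>\<^sup>2 = s\<^sup>2\<close>, they become \<open>ln E exp (s Y\<^sub>r) \<rightarrow> s\<^sup>2 v / 2\<close>: the moment generating functions of the
  \<open>Y\<^sub>r\<close> converge everywhere to that of \<open>N(0, v)\<close> (\<open>mgf_tendsto_of_log_exp_moment_limit\<close>,
  \<open>normal_distribution_mgf\<close>).

  It remains to pass from moment generating functions to weak convergence (Curtiss' theorem,
  \<open>weak_conv_of_mgf_tendsto\<close>). This is a power series version of Vitali's convergence theorem.
  The power series \<open>\<Sum>k. E Y\<^sup>k / k! * z\<^sup>k\<close> represents the moment generating function at real \<open>z\<close> and
  the characteristic function at imaginary \<open>z\<close>. Convergence at all small real \<open>z\<close>, with a uniform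
  bound on the coefficients, forces every coefficient to converge
  (\<open>power_series_coeffs_tendsto_0\<close>); dominated convergence of the series then gives convergence at
  imaginary \<open>z\<close> (\<open>char_tendsto_of_mgf_tendsto\<close>), and Levy's continuity theorem applies.
  Weak convergence along the real parameter \<open>r\<close> is tested on sequences \<open>r\<^sub>n \<rightarrow> \<infinity>\<close>.
\<close>


section \<open>Recovering limits of coefficients from limits of power series\<close>

text \<open>
  Once the coefficients below \<open>k\<close> tend to \<open>0\<close>, dividing the series without its first \<open>k\<close> terms by
  \<open>x\<^sup>k\<close> leaves \<open>d n k\<close> up to an error \<open>O(x)\<close> that is uniform in \<open>n\<close>, by the bound on the
  coefficients. Hence \<open>limsup \<bar>d n k\<bar> = O(x)\<close> for all small \<open>x > 0\<close>.
\<close>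

lemma power_series_coeffs_tendsto_0:
  fixes d :: "nat \<Rightarrow> nat \<Rightarrow> real"
  assumes "A > 0" and bound: "\<And>n k. \<bar>d n k\<bar> * A ^ k \<le> C"
    and lim: "\<And>x. 0 < x \<Longrightarrow> x < A \<Longrightarrow> (\<lambda>n. \<Sum>k. d n k * x ^ k) \<longlonglongrightarrow> 0"
  shows "(\<lambda>n. d n k) \<longlonglongrightarrow> 0"
proof (induction k rule: less_induct)
  case (less k)
  define h where "h = (\<lambda>n x. (\<Sum>j. d n j * x ^ j) - (\<Sum>j<k. d n j * x ^ j))"
  have h_lim: "(\<lambda>n. h n x) \<longlonglongrightarrow> 0" if "0 < x" "x < A" for x
  proof -
    have "(\<lambda>n. \<Sum>j<k. d n j * x ^ j) \<longlonglongrightarrow> (\<Sum>j<k. 0 * x ^ j)"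
      by (intro tendsto_intros less.IH) auto
    from tendsto_diff[OF lim[OF that] this] show ?thesis
      by (simp add: h_def)
  qed
  have C: "C \<ge> 0"
    using bound[of 0 0] by simp
  \<comment> \<open>For \<open>x / A \<le> 1 / 2\<close> the tail is at most twice its first majorising term \<open>C * (x / A) ^ Suc k\<close>.\<close>
  have near: "\<bar>d n k - h n x / x ^ k\<bar> \<le> x * (2 * C / A ^ Suc k)" if x: "0 < x" "x \<le> A / 2" for n x
  proof -
    define q where "q = x / A"
    have q: "0 < q" "q \<le> 1 / 2"
      using x \<open>A > 0\<close> by (auto simp: q_def field_simps)
    have term_le: "norm (d n j * x ^ j) \<le> C * q ^ j" for j
    proof -
      have "norm (d n j * x ^ j) = (\<bar>d n j\<bar> * A ^ j) * q ^ j"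
        using x \<open>A > 0\<close> by (simp add: q_def abs_mult power_divide)
      also have "\<dots> \<le> C * q ^ j"
        using bound q by (intro mult_right_mono) auto
      finally show ?thesis .
    qed
    have geom: "summable (\<lambda>j. C * q ^ j)"
      using q by (intro summable_mult) auto
    have summ: "summable (\<lambda>j. norm (d n j * x ^ j))" 
      by (rule summable_comparison_test'[OF geom, of 0]) (use term_le in auto)
    define tail where "tail = (\<Sum>j. d n (j + Suc k) * x ^ (j + Suc k))"
    have "h n x = tail + d n k * x ^ k"
      unfolding h_def tail_def
      by (subst suminf_split_initial_segment[OF summable_norm_cancel[OF summ], of "Suc k"]) simp
    then have "\<bar>d n k - h n x / x ^ k\<bar> = \<bar>tail\<bar> / x ^ k"
      using x by (simp add: field_simps abs_divide)
    also have "\<bar>tail\<bar> \<le> (\<Sum>j. norm (d n (j + Suc k) * x ^ (j + Suc k)))"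
      unfolding tail_def
      using summable_norm[OF summable_ignore_initial_segment[OF summ, of "Suc k"]] by (simp only: real_norm_def)
    also have "\<dots> \<le> (\<Sum>j. C * q ^ (j + Suc k))"
      by (intro suminf_le term_le summable_ignore_initial_segment[OF summ]
          summable_ignore_initial_segment[OF geom])
    also have "\<dots> = (\<Sum>j. C * q ^ Suc k * q ^ j)"
      by (simp add: power_add mult_ac)
    also have "\<dots> = C * q ^ Suc k * (1 / (1 - q))"
      using q by (subst suminf_mult) (auto simp: suminf_geometric)
    also have "\<dots> \<le> C * q ^ Suc k * 2"
      using q C by (intro mult_left_mono) (auto simp: field_simps)
    also have "C * q ^ Suc k * 2 / x ^ k = x * (2 * C / A ^ Suc k)"
      using x \<open>A > 0\<close> by (simp add: q_def field_simps)
    finally show ?thesis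
      using x by (simp add: divide_right_mono)
  qed
  show ?case
  proof (rule LIMSEQ_I)
    fix e :: real assume "e > 0"
    define c where "c = 2 * C / A ^ Suc k"
    have "c \<ge> 0"
      using C \<open>A > 0\<close> by (simp add: c_def)
    \<comment> \<open>The \<open>+ 1\<close> keeps the denominator positive when \<open>c = 0\<close>.\<close>
    define x where "x = min (A / 2) (e / (2 * (c + 1)))"
    have x: "0 < x" "x \<le> A / 2"
      unfolding x_def using \<open>A > 0\<close> \<open>e > 0\<close> \<open>c \<ge> 0\<close>
      by (simp_all only: min.cobounded1) simp
    have "x * c \<le> e / (2 * (c + 1)) * c"
      using \<open>c \<ge> 0\<close> by (intro mult_right_mono) (auto simp: x_def)
    also have "\<dots> < e / 2"
      using \<open>c \<ge> 0\<close> \<open>e > 0\<close> by (simp add: field_simps)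
    finally have xc: "x * c < e / 2" .
    have "(\<lambda>n. h n x / x ^ k) \<longlonglongrightarrow> 0 / x ^ k"
      using x \<open>A > 0\<close> by (intro tendsto_divide h_lim tendsto_const) auto
    then obtain N where N: "\<And>n. n \<ge> N \<Longrightarrow> \<bar>h n x / x ^ k\<bar> < e / 2"
      using LIMSEQ_D[of "\<lambda>n. h n x / x ^ k" 0 "e / 2"] \<open>e > 0\<close> by auto
    have "norm (d n k - 0) < e" if "n \<ge> N" for n
      using near[OF x, of n] N[OF that] xc unfolding c_def real_norm_def by linarith
    then show "\<exists>N. \<forall>n\<ge>N. norm (d n k - 0) < e"
      by blast
  qed
qed


section \<open>Moment generating functions as power series\<close>

definition mgf_coeff :: "real measure \<Rightarrow> nat \<Rightarrow> real" where
  "mgf_coeff \<mu> k = (\<integral>x. x ^ k \<partial>\<mu>) / fact k"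

text \<open>
  The sum of the two exponentials dominates \<open>exp (A * \<bar>x\<bar>)\<close>, hence each term of its series. It
  serves as the integrable majorant for powers and for partial sums of exponential series.
\<close>

lemma abs_power_le_exp:
  fixes A x :: real
  assumes "A \<ge> 0"
  shows "\<bar>x\<bar> ^ k * A ^ k / fact k \<le> exp (A * x) + exp (- A * x)"
proof -
  have "(A * \<bar>x\<bar>) ^ k / fact k \<le> exp (A * \<bar>x\<bar>)"
    using sum_le_suminf[of "\<lambda>n. (A * \<bar>x\<bar>) ^ n /\<^sub>R fact n" "{k}"]
      exp_converges[of "A * \<bar>x\<bar>"] assms
    by (simp add: sums_iff divide_inverse mult.commute)
  also have "\<dots> \<le> exp (A * x) + exp (- A * x)"
    by (cases "x \<ge> 0") auto
  finally show ?thesis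
    by (simp add: power_mult_distrib mult_ac)
qed

context
  fixes \<mu> :: "real measure" and A :: real
  assumes distr: "real_distribution \<mu>" and "A > 0"
    and int_pos: "integrable \<mu> (\<lambda>x. exp (A * x))"
    and int_neg: "integrable \<mu> (\<lambda>x. exp (- A * x))"
begin

interpretation real_distribution \<mu> by (rule distr)

lemma integrable_power: "integrable \<mu> (\<lambda>x. x ^ k)"
proof (rule Bochner_Integration.integrable_bound)
  show "integrable \<mu> (\<lambda>x. fact k / A ^ k * (exp (A * x) + exp (- A * x)))"
    using int_pos int_neg by (intro integrable_mult_right Bochner_Integration.integrable_add)
  show "AE x in \<mu>. norm (x ^ k) \<le> norm (fact k / A ^ k * (exp (A * x) + exp (- A * x)))"
    using abs_power_le_exp[of A _ k] \<open>A > 0\<close> 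
    by (auto simp: power_abs field_simps)
qed simp

lemma mgf_coeff_bound:
  "\<bar>mgf_coeff \<mu> k\<bar> * A ^ k \<le> (\<integral>x. exp (A * x) \<partial>\<mu>) + (\<integral>x. exp (- A * x) \<partial>\<mu>)"
proof -
  have "\<bar>mgf_coeff \<mu> k\<bar> * A ^ k = \<bar>\<integral>x. x ^ k * A ^ k / fact k \<partial>\<mu>\<bar>"
    using \<open>A > 0\<close> by (simp add: mgf_coeff_def abs_mult abs_divide)
  also have "\<dots> \<le> (\<integral>x. \<bar>x ^ k * A ^ k / fact k\<bar> \<partial>\<mu>)"
    by (rule integral_abs_bound)
  also have "\<dots> \<le> (\<integral>x. exp (A * x) + exp (- A * x) \<partial>\<mu>)"
    using int_pos int_neg integrable_power abs_power_le_exp[of A _ k] \<open>A > 0\<close>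
    by (intro integral_mono integrable_abs Bochner_Integration.integrable_add) (auto simp: abs_mult power_abs)
  finally show ?thesis
    using int_pos int_neg by simp
qed

text \<open>
  Admitting complex \<open>z\<close> lets one expansion serve both for the moment generating function (\<open>z\<close>
  real) and for the characteristic function (\<open>z\<close> imaginary). Integrating term by term is justified
  by dominated convergence.
\<close>

lemma mgf_coeff_sums:
  fixes z :: complex
  assumes z: "norm z \<le> A"
  shows "(\<lambda>k. of_real (mgf_coeff \<mu> k) * z ^ k) sums (\<integral>x. exp (z * of_real x) \<partial>\<mu>)"
proof -
  let ?t = "\<lambda>x k. (z * of_real x) ^ k /\<^sub>R fact k"
  have "(\<lambda>n. \<integral>x. (\<Sum>k<n. ?t x k) \<partial>\<mu>) \<longlonglongrightarrow> (\<integral>x. exp (z * of_real x) \<partial>\<mu>)"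
  proof (rule integral_dominated_convergence)
    show "integrable \<mu> (\<lambda>x. exp (A * x) + exp (- A * x))"
      using int_pos int_neg by simp
    show "AE x in \<mu>. (\<lambda>n. \<Sum>k<n. ?t x k) \<longlonglongrightarrow> exp (z * of_real x)"
      using exp_converges unfolding sums_def by blast
    show "AE x in \<mu>. norm (\<Sum>k<n. ?t x k) \<le> exp (A * x) + exp (- A * x)" for n
    proof (rule AE_I2)
      fix x
      have "norm (\<Sum>k<n. ?t x k) \<le> (\<Sum>k<n. (norm z * \<bar>x\<bar>) ^ k /\<^sub>R fact k)"
        by (rule order.trans[OF norm_sum]) (simp add: norm_power norm_mult)
      also have "\<dots> \<le> exp (norm z * \<bar>x\<bar>)"
        using exp_converges[of "norm z * \<bar>x\<bar>"]
        by (intro order.trans[OF sum_le_suminf]) (auto simp: sums_iff)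
      also have "\<dots> \<le> exp (A * \<bar>x\<bar>)"
        using z by (simp add: mult_right_mono)
      also have "\<dots> \<le> exp (A * x) + exp (- A * x)"
        by (cases "x \<ge> 0") auto
      finally show "norm (\<Sum>k<n. ?t x k) \<le> exp (A * x) + exp (- A * x)" .
    qed
  qed auto
  moreover have "(\<integral>x. (\<Sum>k<n. ?t x k) \<partial>\<mu>) = (\<Sum>k<n. of_real (mgf_coeff \<mu> k) * z ^ k)" for n
  proof -
    have "?t x k = of_real (x ^ k) * (z ^ k / of_real (fact k))" for x k
      by (simp add: scaleR_conv_of_real power_mult_distrib divide_simps)
    moreover have "integrable \<mu> (\<lambda>x. of_real (x ^ k) * (z ^ k / of_real (fact k)))" for k
      using integrable_power by (intro integrable_mult_left integrable_of_real)
    moreover have "(\<integral>x. of_real (x ^ k) * (z ^ k / of_real (fact k)) \<partial>\<mu>) = of_real (mgf_coeff \<mu> k) * z ^ k" for k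
      by (simp only: integral_mult_left_zero integral_complex_of_real mgf_coeff_def) simp
    ultimately show ?thesis
      by (simp only: Bochner_Integration.integral_sum)
  qed
  ultimately show ?thesis
    by (simp add: sums_def)
qed

lemma mgf_coeff_sums_real:
  assumes "\<bar>t\<bar> \<le> A"
  shows "(\<lambda>k. mgf_coeff \<mu> k * t ^ k) sums (\<integral>x. exp (t * x) \<partial>\<mu>)"
proof -
  have "(\<integral>x. exp (of_real t * of_real x) \<partial>\<mu>) = complex_of_real (\<integral>x. exp (t * x) \<partial>\<mu>)"
    by (simp only: of_real_mult[symmetric] exp_of_real integral_complex_of_real)
  then have "(\<lambda>k. complex_of_real (mgf_coeff \<mu> k * t ^ k)) sums complex_of_real (\<integral>x. exp (t * x) \<partial>\<mu>)"
    using mgf_coeff_sums[of "of_real t"] assms by simp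
  then show ?thesis
    by (simp only: sums_of_real_iff)
qed

end


section \<open>Convergence of moment generating functions implies weak convergence\<close>

text \<open>
  Both hypotheses of the coefficient lemma come from the convergence of the moment generating
  functions: the values at \<open>A\<close> and \<open>- A\<close> are bounded in \<open>n\<close> and bound the coefficients by
  \<open>C / A\<^sup>k\<close>, and this geometric bound then dominates the series at \<open>\<i> t\<close> because \<open>\<bar>t\<bar> < A\<close>.
\<close>

lemma char_tendsto_of_mgf_tendsto:
  fixes \<mu> :: "nat \<Rightarrow> real measure" and \<nu> :: "real measure"
  assumes distr: "\<And>n. real_distribution (\<mu> n)" "real_distribution \<nu>"
    and "A > 0" "\<bar>t\<bar> < A"
    and int: "\<And>n. integrable (\<mu> n) (\<lambda>x. exp (A * x))" "\<And>n. integrable (\<mu> n) (\<lambda>x. exp (- A * x))"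
    and int': "integrable \<nu> (\<lambda>x. exp (A * x))" "integrable \<nu> (\<lambda>x. exp (- A * x))"
    and conv: "\<And>s. \<bar>s\<bar> \<le> A \<Longrightarrow> (\<lambda>n. \<integral>x. exp (s * x) \<partial>\<mu> n) \<longlonglongrightarrow> (\<integral>x. exp (s * x) \<partial>\<nu>)"
  shows "(\<lambda>n. char (\<mu> n) t) \<longlonglongrightarrow> char \<nu> t"
proof -
  note facts = distr(1) \<open>A > 0\<close> int and facts' = distr(2) \<open>A > 0\<close> int'
  define d where "d = (\<lambda>n k. mgf_coeff (\<mu> n) k - mgf_coeff \<nu> k)"
  let ?S = "\<lambda>\<rho>. (\<integral>x. exp (A * x) \<partial>\<rho>) + (\<integral>x. exp (- A * x) \<partial>\<rho>)"
  have "convergent (\<lambda>n. ?S (\<mu> n))"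
    using conv[of A] conv[of "- A"] \<open>A > 0\<close> by (intro convergent_add) (auto simp: convergent_def)
  from convergent_imp_Bseq[OF this] obtain B where "\<forall>n. norm (?S (\<mu> n)) \<le> B"
    unfolding Bseq_def by blast
  then have B: "\<bar>?S (\<mu> n)\<bar> \<le> B" for n
    by simp
  define C where "C = B + ?S \<nu>"
  have d_bound: "\<bar>d n k\<bar> * A ^ k \<le> C" for n k
  proof -
    have "\<bar>d n k\<bar> * A ^ k \<le> \<bar>mgf_coeff (\<mu> n) k\<bar> * A ^ k + \<bar>mgf_coeff \<nu> k\<bar> * A ^ k"
      unfolding d_def distrib_right[symmetric] using \<open>A > 0\<close> by (intro mult_right_mono) auto
    also have "\<dots> \<le> ?S (\<mu> n) + ?S \<nu>"
      by (intro add_mono mgf_coeff_bound facts facts')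
    also have "\<dots> \<le> C"
      using B[of n] by (auto simp: C_def)
    finally show ?thesis .
  qed
  have d_lim: "(\<lambda>n. d n k) \<longlonglongrightarrow> 0" for k
  proof (rule power_series_coeffs_tendsto_0[OF \<open>A > 0\<close> d_bound])
    fix x assume x: "0 < x" "x < A"
    have "(\<lambda>k. d n k * x ^ k) sums ((\<integral>y. exp (x * y) \<partial>\<mu> n) - (\<integral>y. exp (x * y) \<partial>\<nu>))" for n
      unfolding d_def left_diff_distrib using x
      by (intro sums_diff mgf_coeff_sums_real[OF facts] mgf_coeff_sums_real[OF facts']) auto
    moreover have "(\<lambda>n. (\<integral>y. exp (x * y) \<partial>\<mu> n) - (\<integral>y. exp (x * y) \<partial>\<nu>)) \<longlonglongrightarrow> 0"
      using conv[of x] x by (intro LIM_zero) auto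
    ultimately show "(\<lambda>n. \<Sum>k. d n k * x ^ k) \<longlonglongrightarrow> 0"
      by (simp add: sums_iff)
  qed
  define z where "z = \<i> * complex_of_real t"
  have z: "norm z = \<bar>t\<bar>"
    by (simp add: z_def norm_mult)
  have "(\<lambda>n. \<Sum>k. of_real (d n k) * z ^ k) \<longlonglongrightarrow> (\<Sum>k. 0 :: complex)"
  proof (rule tannerys_theorem[THEN conjunct2, THEN conjunct2])
    show "(\<lambda>n. of_real (d n k) * z ^ k) \<longlonglongrightarrow> (0 :: complex)" for k
      using tendsto_mult_left_zero[OF tendsto_of_real[OF d_lim, simplified]] .
    have "norm (of_real (d n k) * z ^ k) \<le> C * (\<bar>t\<bar> / A) ^ k" for n k
    proof -
      have "norm (of_real (d n k) * z ^ k) = (\<bar>d n k\<bar> * A ^ k) * (\<bar>t\<bar> / A) ^ k"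
        using \<open>A > 0\<close> z by (simp add: norm_mult norm_power power_divide)
      also have "\<dots> \<le> C * (\<bar>t\<bar> / A) ^ k"
        using d_bound \<open>A > 0\<close> by (intro mult_right_mono) auto
      finally show ?thesis .
    qed
    then show "\<forall>\<^sub>F (k, n) in sequentially \<times>\<^sub>F sequentially.
        norm (of_real (d n k) * z ^ k) \<le> C * (\<bar>t\<bar> / A) ^ k"
      by (intro always_eventually) auto
    show "summable (\<lambda>k. C * (\<bar>t\<bar> / A) ^ k)"
      using \<open>A > 0\<close> \<open>\<bar>t\<bar> < A\<close> by (intro summable_mult) simp
  qed simp
  moreover have "(\<lambda>k. of_real (d n k) * z ^ k) sums (char (\<mu> n) t - char \<nu> t)" for n
  proof -
    have char: "char \<rho> t = (\<integral>x. exp (z * of_real x) \<partial>\<rho>)" for \<rho>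
      by (simp add: char_def z_def mult_ac)
    have "norm z \<le> A"
      using z \<open>\<bar>t\<bar> < A\<close> by simp
    then show ?thesis
      unfolding d_def char of_real_diff left_diff_distrib
      by (intro sums_diff mgf_coeff_sums[OF facts] mgf_coeff_sums[OF facts'])
  qed
  ultimately have "(\<lambda>n. char (\<mu> n) t - char \<nu> t) \<longlonglongrightarrow> 0"
    by (simp add: sums_iff)
  then show ?thesis
    by (rule LIM_zero_cancel)
qed

text \<open>
  Curtiss' theorem, for moment generating functions that converge on the whole real line. Each
  \<open>\<mu> n\<close> may lack some exponential moments, as long as for every \<open>s\<close> this happens for finitely many
  \<open>n\<close> only; for a given \<open>t\<close>, an initial segment of the sequence is discarded.
\<close>

theorem weak_conv_of_mgf_tendsto:
  fixes \<mu> :: "nat \<Rightarrow> real measure" and \<nu> :: "real measure"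
  assumes distr: "\<And>n. real_distribution (\<mu> n)" "real_distribution \<nu>"
    and int: "\<And>s. \<forall>\<^sub>F n in sequentially. integrable (\<mu> n) (\<lambda>x. exp (s * x))"
    and int': "\<And>s. integrable \<nu> (\<lambda>x. exp (s * x))"
    and conv: "\<And>s. (\<lambda>n. \<integral>x. exp (s * x) \<partial>\<mu> n) \<longlonglongrightarrow> (\<integral>x. exp (s * x) \<partial>\<nu>)"
  shows "weak_conv_m \<mu> \<nu>"
proof (rule levy_continuity[OF distr])
  fix t :: real
  define A where "A = \<bar>t\<bar> + 1"
  obtain N where N: "\<And>n. n \<ge> N \<Longrightarrow> integrable (\<mu> n) (\<lambda>x. exp (A * x))"
    "\<And>n. n \<ge> N \<Longrightarrow> integrable (\<mu> n) (\<lambda>x. exp (- A * x))"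
    using eventually_conj[OF int[of A] int[of "- A"]] by (auto simp: eventually_sequentially)
  have "(\<lambda>n. char (\<mu> (n + N)) t) \<longlonglongrightarrow> char \<nu> t"
  proof (rule char_tendsto_of_mgf_tendsto[where A = A])
    show "(\<lambda>n. \<integral>x. exp (s * x) \<partial>\<mu> (n + N)) \<longlonglongrightarrow> (\<integral>x. exp (s * x) \<partial>\<nu>)" for s
      using conv by (rule LIMSEQ_ignore_initial_segment)
  qed (use distr N int'[of A] int'[of "- A"] in \<open>auto simp: A_def\<close>)
  then show "(\<lambda>n. char (\<mu> n) t) \<longlonglongrightarrow> char \<nu> t"
    by (rule LIMSEQ_offset)
qed


section \<open>The moment generating function of a normal distribution\<close>

lemma real_distribution_normal_distribution:
  assumes "v \<ge> 0"
  shows "real_distribution (normal_distribution m v)"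
proof (cases "v = 0")
  case True
  interpret prob_space "return borel m"
    by (rule prob_space_return) simp
  show ?thesis
    using True prob_space_axioms
    by (simp add: normal_distribution_def real_distribution_def real_distribution_axioms_def)
next
  case False
  interpret prob_space "density lborel (normal_density m (sqrt v))"
    using assms False by (intro prob_space_normal_density) simp
  show ?thesis
    using False prob_space_axioms
    by (simp add: normal_distribution_def real_distribution_def real_distribution_axioms_def)
qed

lemma normal_distribution_mgf:
  assumes "v \<ge> 0"
  shows "integrable (normal_distribution 0 v) (\<lambda>x. exp (t * x))" (is ?int)
    and "(\<integral>x. exp (t * x) \<partial>normal_distribution 0 v) = exp (t\<^sup>2 * v / 2)" (is ?eq)
proof -
  have "?int \<and> ?eq"
  proof (cases "v = 0")
    case True
    have "integrable (return borel 0) (\<lambda>x. exp (t * x))"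
      by (subst integrable_iff_bounded) (auto simp: nn_integral_return)
    with True show ?thesis
      by (simp add: normal_distribution_def integral_return)
  next
    case False
    then have v: "v > 0"
      using assms by simp
    \<comment> \<open>Completing the square: an exponential tilt shifts the mean by \<open>v * t\<close>.\<close>
    have tilt: "normal_density 0 (sqrt v) x * exp (t * x)
      = exp (t\<^sup>2 * v / 2) * normal_density (v * t) (sqrt v) x" for x
    proof -
      have "-(x - 0)\<^sup>2 / (2 * v) + t * x = t\<^sup>2 * v / 2 + -(x - v * t)\<^sup>2 / (2 * v)"
        using v by (simp add: field_simps power2_eq_square)
      then have "exp (-(x - 0)\<^sup>2 / (2 * v)) * exp (t * x) = exp (t\<^sup>2 * v / 2) * exp (-(x - v * t)\<^sup>2 / (2 * v))"
        by (simp only: exp_add[symmetric])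
      then show ?thesis
        using v by (simp add: normal_density_def)
    qed
    show ?thesis
      using v by (simp add: normal_distribution_def integrable_density integral_density tilt)
  qed
  then show ?int ?eq
    by auto
qed


section \<open>From exponential moment asymptotics to weak convergence\<close>

lemma borel_measurable_scaled_integral:
  assumes X: "random_process M X" and g: "continuous_on UNIV g"
  shows "scaled_integral g X r \<in> borel_measurable M"
proof -
  have [measurable]: "case_prod X \<in> borel_measurable (borel \<Otimes>\<^sub>M M)"
    using X by (simp add: random_process_def)
  have [measurable]: "g \<in> borel_measurable borel"
    using g by (rule borel_measurable_continuous_onI)
  have "(\<lambda>\<omega>. LBINT t. g (t / r) * case_prod X (t, \<omega>)) \<in> borel_measurable M"
    by measurable
  then show ?thesis
    by (simp add: scaled_integral_def[abs_def])
qed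

text \<open>
  The choice \<open>l = t * r powr (-1/2)\<close> turns the normalising factor \<open>r * l\<^sup>2\<close> into the constant
  \<open>t\<^sup>2\<close>, and it is admissible because \<open>\<bar>l\<bar> * ln r\<close> tends to \<open>0\<close>.
\<close>

lemma mgf_tendsto_of_log_exp_moment_limit:
  assumes M: "prob_space M" and lim: "log_exp_moment_limit M X g L" and "t \<noteq> 0"
  defines "Y \<equiv> \<lambda>r \<omega>. r powr (-1/2) * scaled_integral g X r \<omega>"
  shows "\<forall>\<^sub>F r in at_top. integrable M (\<lambda>\<omega>. exp (t * Y r \<omega>))"
    and "((\<lambda>r. \<integral>\<omega>. exp (t * Y r \<omega>) \<partial>M) \<longlongrightarrow> exp (t\<^sup>2 * L)) at_top"
proof -
  interpret prob_space M by (rule M)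
  have small: "\<forall>\<^sub>F r in at_top. \<bar>t * r powr (-1/2)\<bar> * ln r \<le> \<delta>" if "\<delta> > 0" for \<delta>
  proof -
    have "((\<lambda>r::real. \<bar>t\<bar> * (r powr (-1/2) * ln r)) \<longlongrightarrow> \<bar>t\<bar> * 0) at_top"
      by (intro tendsto_mult tendsto_const) real_asymp
    then have "\<forall>\<^sub>F r in at_top. \<bar>t\<bar> * (r powr (-1/2) * ln r) < \<delta>"
      using that by (intro order_tendstoD) auto
    then show ?thesis
      by eventually_elim (simp add: abs_mult mult_ac)
  qed
  have ev: "\<forall>\<^sub>F r in at_top. integrable M (\<lambda>\<omega>. exp (t * Y r \<omega>)) \<and>
      \<bar>1 / t\<^sup>2 * ln (\<integral>\<omega>. exp (t * Y r \<omega>) \<partial>M) - L\<bar> < \<epsilon>" if "\<epsilon> > 0" for \<epsilon>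
  proof -
    obtain R \<delta> where "\<delta> > 0" and R: "\<And>r l. r \<ge> R \<Longrightarrow> l \<noteq> 0 \<Longrightarrow> \<bar>l\<bar> * ln r \<le> \<delta> \<Longrightarrow>
        integrable M (\<lambda>\<omega>. exp (l * scaled_integral g X r \<omega>)) \<and>
        \<bar>1 / (r * l\<^sup>2) * ln (\<integral>\<omega>. exp (l * scaled_integral g X r \<omega>) \<partial>M) - L\<bar> < \<epsilon>"
      using lim \<open>\<epsilon> > 0\<close> unfolding log_exp_moment_limit_def by metis
    show ?thesis
      using small[OF \<open>\<delta> > 0\<close>] eventually_ge_at_top[of R] eventually_gt_at_top[of 0]
    proof eventually_elim
      case (elim r)
      have "(r powr (-1/2))\<^sup>2 = r powr (-1)"
        by (simp add: power2_eq_square flip: powr_add)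
      then have "r * (t * r powr (-1/2))\<^sup>2 = t\<^sup>2"
        using \<open>r > 0\<close> by (simp add: power_mult_distrib powr_neg_one)
      then show ?case
        using R[OF elim(2), of "t * r powr (-1/2)"] elim \<open>t \<noteq> 0\<close> by (simp add: Y_def mult.assoc)
    qed
  qed
  show int: "\<forall>\<^sub>F r in at_top. integrable M (\<lambda>\<omega>. exp (t * Y r \<omega>))"
    using ev[OF zero_less_one] by eventually_elim simp
  have "((\<lambda>r. 1 / t\<^sup>2 * ln (\<integral>\<omega>. exp (t * Y r \<omega>) \<partial>M)) \<longlongrightarrow> L) at_top"
    unfolding tendsto_iff dist_real_def using ev by (blast intro: eventually_mono)
  then have "((\<lambda>r. exp (t\<^sup>2 * (1 / t\<^sup>2 * ln (\<integral>\<omega>. exp (t * Y r \<omega>) \<partial>M)))) \<longlongrightarrow> exp (t\<^sup>2 * L)) at_top"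
    by (intro tendsto_intros)
  moreover have "\<forall>\<^sub>F r in at_top. exp (t\<^sup>2 * (1 / t\<^sup>2 * ln (\<integral>\<omega>. exp (t * Y r \<omega>) \<partial>M)))
      = (\<integral>\<omega>. exp (t * Y r \<omega>) \<partial>M)"
    using int
  proof eventually_elim
    case (elim r)
    \<comment> \<open>Positivity is what allows undoing the logarithm, since \<open>ln 0 = 0\<close>.\<close>
    have "0 < (\<integral>\<omega>. exp (t * Y r \<omega>) \<partial>M)"
      using integral_less_AE_space[of "\<lambda>_. 0"] elim
      by (auto simp: emeasure_space_1)
    then show ?case
      using \<open>t \<noteq> 0\<close> by simp
  qed
  ultimately show "((\<lambda>r. \<integral>\<omega>. exp (t * Y r \<omega>) \<partial>M) \<longlongrightarrow> exp (t\<^sup>2 * L)) at_top"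
    by (rule Lim_transform_eventually)
qed

theorem corollary4:
  fixes M :: "'a measure" and X :: "real \<Rightarrow> 'a \<Rightarrow> real"
    and \<sigma> :: real and f :: "real \<Rightarrow> real"
  assumes "random_process M X"
    and "stationary M X"
    and "splittable TYPE('b) M X"
    and "\<sigma> \<ge> 0"
    and "\<And>g. continuous_on UNIV g \<Longrightarrow> compactly_supported g \<Longrightarrow>
           log_exp_moment_limit M X g (\<sigma>\<^sup>2 / 2 * (L2_norm g)\<^sup>2)"
    and "continuous_on UNIV f" and "compactly_supported f"
  shows "weakly_converges
           (\<lambda>r. distr M borel (\<lambda>\<omega>. r powr (-1/2) * scaled_integral f X r \<omega>))
           (normal_distribution 0 (\<sigma>\<^sup>2 * (L2_norm f)\<^sup>2)) at_top"
proof -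
  interpret prob_space M
    using assms(1) by (simp add: random_process_def)
  define v where "v = \<sigma>\<^sup>2 * (L2_norm f)\<^sup>2"
  have "v \<ge> 0"
    by (simp add: v_def)
  define Y where "Y = (\<lambda>r \<omega>. r powr (-1/2) * scaled_integral f X r \<omega>)"
  note [measurable] = borel_measurable_scaled_integral[OF assms(1,6)]
  have Y [measurable]: "Y r \<in> borel_measurable M" for r
    unfolding Y_def by measurable
  have lim: "log_exp_moment_limit M X f (v / 2)"
    using assms(5-7) by (simp add: v_def)
  have mgf: "(\<forall>\<^sub>F r in at_top. integrable M (\<lambda>\<omega>. exp (t * Y r \<omega>))) \<and>
      ((\<lambda>r. \<integral>\<omega>. exp (t * Y r \<omega>) \<partial>M) \<longlongrightarrow> exp (t\<^sup>2 * v / 2)) at_top" for t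
  proof (cases "t = 0")
    case True
    then show ?thesis
      by (simp add: prob_space)
  next
    case False
    then show ?thesis
      using mgf_tendsto_of_log_exp_moment_limit[OF prob_space_axioms lim] by (simp add: Y_def)
  qed
  have "weakly_converges (\<lambda>r. distr M borel (Y r)) (normal_distribution 0 v) at_top"
    unfolding weakly_converges_def
  proof (intro allI impI tendsto_at_topI_sequentially)
    fix \<phi> :: "real \<Rightarrow> real" and s :: "nat \<Rightarrow> real"
    assume \<phi>: "continuous_on UNIV \<phi>" "bounded (range \<phi>)" and s: "filterlim s at_top sequentially"
    let ?\<mu> = "\<lambda>n. distr M borel (Y (s n))"
    have distr: "real_distribution (?\<mu> n)" "real_distribution (normal_distribution 0 v)" for n
      using \<open>v \<ge> 0\<close> by (simp_all add: real_distribution_normal_distribution)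
    have "weak_conv_m ?\<mu> (normal_distribution 0 v)"
    proof (rule weak_conv_of_mgf_tendsto[OF distr])
      fix t
      have "\<forall>\<^sub>F n in sequentially. integrable M (\<lambda>\<omega>. exp (t * Y (s n) \<omega>))"
        using mgf[of t] s by (intro eventually_compose_filterlim[OF _ s]) auto
      then show "\<forall>\<^sub>F n in sequentially. integrable (?\<mu> n) (\<lambda>x. exp (t * x))"
        by eventually_elim (simp add: integrable_distr_eq)
      show "integrable (normal_distribution 0 v) (\<lambda>x. exp (t * x))"
        using \<open>v \<ge> 0\<close> by (rule normal_distribution_mgf)
      have "(\<lambda>n. \<integral>\<omega>. exp (t * Y (s n) \<omega>) \<partial>M) \<longlonglongrightarrow> exp (t\<^sup>2 * v / 2)"
        using mgf[of t] by (intro filterlim_compose[OF _ s]) auto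
      then show "(\<lambda>n. \<integral>x. exp (t * x) \<partial>?\<mu> n) \<longlonglongrightarrow> (\<integral>x. exp (t * x) \<partial>normal_distribution 0 v)"
        using \<open>v \<ge> 0\<close> by (simp add: integral_distr normal_distribution_mgf)
    qed
    with distr have "weakly_converges ?\<mu> (normal_distribution 0 v) sequentially"
      by (simp add: weakly_converges_sequentially_iff)
    with \<phi> show "(\<lambda>n. \<integral>x. \<phi> x \<partial>?\<mu> n) \<longlonglongrightarrow> (\<integral>x. \<phi> x \<partial>normal_distribution 0 v)"
      by (simp add: weakly_converges_def)
  qed
  then show ?thesis
    by (simp only: Y_def v_def)
qed

end
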